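(* Let $G$ be an essential labelled graph. Let $H$ be a nonempty terminal subgraph of the linking graph $G/_\approx$. Then the set $\Omega=\Sigma(\pi^{-1}(H))$ is an attractor of the dynamical system $(\Sigma(G),\sigma)$. Moreover, all attractors of $(\Sigma(G),\sigma)$ are of this type, i.e. every attractor equals $\Sigma(\pi^{-1}(H))$ for some nonempty terminal subgraph $H$ of $G/_\approx$.
   Context: Let $A$ be a finite alphabet. $A^{\mathbb Z}$ carries the metric $\rho(x,x)=0$ and, for $x\ne y$, $\rho(x,y)=2^{-n}$, where $n$ is the least nonnegative integer with $x_n\neq y_n$ or $x_{-n}\neq y_{-n}$. The shift is $\sigma(x)_i=x_{i+1}$. Attractors. A dynamical system $(X,F)$ is a compact metric space $X$ with a continuous map $F:X\to X$; $d(x,Y)$ denotes the distance of the point $x\in X$ from the set $Y\subset X$. An attractor of $(X,F)$ is a nonempty closed set $Y\subseteq X$ such that: (1) $F(Y)=Y$; (2) for every $\varepsilon>0$ there is $\delta>0$ such that for all $x\in X$, $d(x,Y)<\delta$ implies $d(F^n(x),Y)<\varepsilon$ for all $n>0$; (3) there is $\delta>0$ such that for all $x\in X$, $d(x,Y)<\delta$ implies $\lim_{n\to\infty}d(F^n(x),Y)=0$. Labelled graphs. A labelled graph $G$ over $A$ is a finite directed multigraph (loops and parallel edges allowed) whose edges $e$ carry labels $l(e)\in A$. $\Sigma(G)$ is the set of all $x\in A^{\mathbb Z}$ for which there is a biinfinite walk with edges $(e_i)_{i\in\mathbb Z}$ in $G$ with $l(e_i)=x_i$ for all $i$; it is closed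 and $\sigma$-invariant, and $(\Sigma(G),\sigma)$ is a dynamical system with metric $\rho$. $G$ is essential if every vertex has at least one outgoing and at least one ingoing edge (a loop counts as both). A subgraph $H$ of a graph $G'$ is terminal if no edge of $G'$ starts in $V(H)$ and ends in $V(G')\setminus V(H)$. The components of a graph are its maximal strongly connected subgraphs (walks of length zero allowed, so single vertices count as connected); each vertex lies in exactly one. Linking graph. For a vertex $v$ of $G$ lying in the component $K$ of $G$, the restricted follower set $F(v)$ is the set of all finite words spelled by the labels of walks starting at $v$ and staying in $K$. Vertices $v,w$ are linked, $v\sim w$, if $|F(v)\cap F(w)|=\infty$. Let $\approx$ be the transitive and reflexive closure of $\sim$. The linking graph $G/_\approx$ has as vertices the equivalence classes of $\approx$ on $V(G)$, and there is an edge labelled $a$ from class $X$ to class $Y$ iff there are $u\in X$, $v\in Y$ and an edge labelled $a$ from $u$ to $v$ in $G$. $\pi:V(G)\to V(G/_\approx)$ is the projection to classes, and for a subgraph $H$ of $G/_\approx$, $\pi^{-1}(H)$ denotes the subgraph of $G$ induced by the vertex set $\pi^{-1}(V(H))$. *)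

theory Defs
  imports
    "HOL-Analysis.Abstract_Metric_Spaces"
    "HOL-Analysis.Function_Topology"
    "Graph_Theory.Digraph_Component"
    "Graph_Theory.Arc_Walk"
begin

section \<open>Dynamical systems and attractors\<close>

locale dynamical_system = Metric_space X d
  for X :: "'x set" and d :: "'x \<Rightarrow> 'x \<Rightarrow> real" +
  fixes F :: "'x \<Rightarrow> 'x"
  assumes compact: "compact_space mtopology"
    and continuous: "continuous_map mtopology mtopology F"

text \<open>Only meaningful for nonempty \<open>Y\<close>.\<close>

definition point_set_dist :: "('x \<Rightarrow> 'x \<Rightarrow> real) \<Rightarrow> 'x \<Rightarrow> 'x set \<Rightarrow> real" where
  "point_set_dist d x Y = (INF y\<in>Y. d x y)"

definition (in dynamical_system) attractor :: "'x set \<Rightarrow> bool" where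
  "attractor Y \<longleftrightarrow>
     Y \<noteq> {} \<and> closedin mtopology Y \<and>
     F ` Y = Y \<and>
     (\<forall>\<epsilon>>0. \<exists>\<delta>>0. \<forall>x\<in>X. point_set_dist d x Y < \<delta> \<longrightarrow>
        (\<forall>n>0. point_set_dist d ((F ^^ n) x) Y < \<epsilon>)) \<and>
     (\<exists>\<delta>>0. \<forall>x\<in>X. point_set_dist d x Y < \<delta> \<longrightarrow>
        (\<lambda>n. point_set_dist d ((F ^^ n) x) Y) \<longlonglongrightarrow> 0)"


section \<open>Biinfinite sequences\<close>

definition rho :: "(int \<Rightarrow> 'a) \<Rightarrow> (int \<Rightarrow> 'a) \<Rightarrow> real" where
  "rho x y = (if x = y then 0
     else (1 / 2) ^ (LEAST n::nat. x (int n) \<noteq> y (int n) \<or> x (- int n) \<noteq> y (- int n)))"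

definition shift :: "(int \<Rightarrow> 'a) \<Rightarrow> (int \<Rightarrow> 'a)" where
  "shift x = (\<lambda>i. x (i + 1))"


section \<open>Labelled graphs\<close>

text \<open>
  A labelled graph is a finite multidigraph \<open>G\<close> (in the sense of \<^locale>\<open>fin_digraph\<close>)
  together with a labelling \<open>l\<close> of its arcs.  Subgraphs inherit the labelling, so \<open>l\<close> is kept
  as a separate argument.
\<close>

definition sofic_shift :: "('v, 'e) pre_digraph \<Rightarrow> ('e \<Rightarrow> 'a) \<Rightarrow> (int \<Rightarrow> 'a) set" where
  "sofic_shift G l =
     {x. \<exists>e :: int \<Rightarrow> 'e. \<forall>i. e i \<in> arcs G \<and> head G (e i) = tail G (e (i + 1)) \<and> l (e i) = x i}"

definition essential :: "('v, 'e) pre_digraph \<Rightarrow> bool" where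
  "essential G \<longleftrightarrow> (\<forall>v\<in>verts G. out_arcs G v \<noteq> {} \<and> in_arcs G v \<noteq> {})"

definition terminal :: "('v, 'e) pre_digraph \<Rightarrow> ('v, 'e) pre_digraph \<Rightarrow> bool" where
  "terminal H G \<longleftrightarrow>
     \<not> (\<exists>e\<in>arcs G. tail G e \<in> verts H \<and> head G e \<in> verts G - verts H)"


section \<open>The linking graph\<close>

text \<open>\<^term>\<open>pre_digraph.sccs G\<close> is the set of maximal strongly connected subgraphs; \<open>pre_digraph.awalk K v p w\<close>
  includes \<open>v \<in> verts K\<close> and allows \<open>p = []\<close>.\<close>

definition restricted_follower_set ::
    "('v, 'e) pre_digraph \<Rightarrow> ('e \<Rightarrow> 'a) \<Rightarrow> 'v \<Rightarrow> 'a list set" where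
  "restricted_follower_set G l v =
     {map l p | K p w. K \<in> pre_digraph.sccs G \<and> v \<in> verts K \<and> pre_digraph.awalk K v p w}"

definition linked :: "('v, 'e) pre_digraph \<Rightarrow> ('e \<Rightarrow> 'a) \<Rightarrow> ('v \<times> 'v) set" where
  "linked G l = {(v, w). v \<in> verts G \<and> w \<in> verts G \<and>
     infinite (restricted_follower_set G l v \<inter> restricted_follower_set G l w)}"

definition link_class :: "('v, 'e) pre_digraph \<Rightarrow> ('e \<Rightarrow> 'a) \<Rightarrow> 'v \<Rightarrow> 'v set" where
  "link_class G l v = (linked G l)\<^sup>* `` {v}"

text \<open>An arc of the linking graph is a triple (source class, label, target class), so that there
  is at most one arc with given label and endpoints.\<close>

definition linking_graph ::
    "('v, 'e) pre_digraph \<Rightarrow> ('e \<Rightarrow> 'a) \<Rightarrow> ('v set, 'v set \<times> 'a \<times> 'v set) pre_digraph" where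
  "linking_graph G l =
     \<lparr> verts = verts G // (linked G l)\<^sup>*,
       arcs = {(C, a, D). C \<in> verts G // (linked G l)\<^sup>* \<and> D \<in> verts G // (linked G l)\<^sup>* \<and>
                 (\<exists>e\<in>arcs G. tail G e \<in> C \<and> head G e \<in> D \<and> l e = a)},
       tail = fst,
       head = (\<lambda>t. snd (snd t)) \<rparr>"

definition link_preimage ::
    "('v, 'e) pre_digraph \<Rightarrow> ('e \<Rightarrow> 'a) \<Rightarrow> ('v set, 'v set \<times> 'a \<times> 'v set) pre_digraph
       \<Rightarrow> ('v, 'e) pre_digraph" where
  "link_preimage G l H = G \<restriction> {v \<in> verts G. link_class G l v \<in> verts H}"


section \<open>The shift on a labelled graph is a dynamical system\<close>

lemma rho_less_iff:
  "rho x y < (1 / 2) ^ n \<longleftrightarrow> (\<forall>i. \<bar>i\<bar> \<le> int n \<longrightarrow> x i = y i)"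
proof (cases "x = y")
  case False
  let ?P = "\<lambda>n::nat. x (int n) \<noteq> y (int n) \<or> x (- int n) \<noteq> y (- int n)"
  define m where "m = (LEAST n. ?P n)"
  obtain i where i: "x i \<noteq> y i" using False by blast
  have "?P (nat \<bar>i\<bar>)" using i by (cases "i \<ge> 0") auto
  then have m: "?P m" unfolding m_def by (rule LeastI)
  have least: "\<not> ?P k" if "k < m" for k using not_less_Least that unfolding m_def by blast
  have "rho x y < (1 / 2) ^ n \<longleftrightarrow> n < m"
    unfolding rho_def m_def[symmetric] using False by simp
  also have "n < m \<longleftrightarrow> (\<forall>i. \<bar>i\<bar> \<le> int n \<longrightarrow> x i = y i)"
  proof
    assume nm: "n < m"
    show "\<forall>i. \<bar>i\<bar> \<le> int n \<longrightarrow> x i = y i"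
    proof (intro allI impI)
      fix i :: int
      assume "\<bar>i\<bar> \<le> int n"
      then have "\<not> ?P (nat \<bar>i\<bar>)" using nm by (intro least) linarith
      then show "x i = y i" by (cases "i \<ge> 0") auto
    qed
  next
    assume eq: "\<forall>i. \<bar>i\<bar> \<le> int n \<longrightarrow> x i = y i"
    show "n < m"
    proof (rule ccontr)
      assume "\<not> n < m"
      then have "\<not> ?P m" using eq by auto
      with m show False by blast
    qed
  qed
  finally show ?thesis .
qed (simp add: rho_def)

lemma rho_cases:
  assumes "x \<noteq> y"
  obtains n where "rho x y = (1 / 2) ^ n"
  using assms by (auto simp: rho_def)

lemma Metric_space_rho: "Metric_space M rho"
proof
  show nonneg: "0 \<le> rho x y" for x y :: "int \<Rightarrow> 'a" by (simp add: rho_def)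
  show sym: "rho x y = rho y x" for x y :: "int \<Rightarrow> 'a"
    by (simp add: rho_def eq_commute[of "x _"] eq_commute[of x])
  show "rho x y = 0 \<longleftrightarrow> x = y" for x y :: "int \<Rightarrow> 'a" by (simp add: rho_def)
  show "rho x z \<le> rho x y + rho y z" for x y z :: "int \<Rightarrow> 'a"
  proof (cases "x = z")
    case True
    then show ?thesis using nonneg[of x y] nonneg[of y z] by (simp add: rho_def)
  next
    case False
    then obtain n where n: "rho x z = (1 / 2) ^ n" by (rule rho_cases)
    have "rho x y \<ge> (1 / 2) ^ n \<or> rho y z \<ge> (1 / 2) ^ n"
    proof (rule ccontr)
      assume "\<not> ?thesis"
      then have "rho x y < (1 / 2) ^ n" "rho y z < (1 / 2) ^ n" by auto
      then have "rho x z < (1 / 2) ^ n" unfolding rho_less_iff by simp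
      with n show False by simp
    qed
    then show ?thesis using n nonneg[of x y] nonneg[of y z] by auto
  qed
qed

lemma power_half_less: "\<exists>n::nat. (1 / 2) ^ n < (\<epsilon>::real)" if "\<epsilon> > 0"
  using real_arch_pow_inv[OF that, of "1 / 2"] by simp

lemma shift_in_sofic_shift: "x \<in> sofic_shift G l \<Longrightarrow> shift x \<in> sofic_shift G l"
proof -
  assume "x \<in> sofic_shift G l"
  then obtain e where "\<forall>i. e i \<in> arcs G \<and> head G (e i) = tail G (e (i + 1)) \<and> l (e i) = x i"
    unfolding sofic_shift_def by blast
  then show ?thesis
    unfolding sofic_shift_def shift_def by (intro CollectI exI[of _ "\<lambda>i. e (i + 1)"]) auto
qed

lemma continuous_map_shift:
  "continuous_map (Metric_space.mtopology (sofic_shift G l) rho)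
     (Metric_space.mtopology (sofic_shift G l) rho) shift"
proof -
  interpret Metric_space "sofic_shift G l" rho by (rule Metric_space_rho)
  show ?thesis
    unfolding continuous_map_to_metric
  proof (intro ballI allI impI)
    fix x and \<epsilon> :: real
    assume x: "x \<in> topspace mtopology" and \<epsilon>: "\<epsilon> > 0"
    obtain n :: nat where n: "(1 / 2) ^ n < \<epsilon>" using power_half_less \<epsilon> by blast
    have "shift y \<in> mball (shift x) \<epsilon>" if "y \<in> mball x ((1 / 2) ^ Suc n)" for y
    proof -
      have xy: "\<forall>i. \<bar>i\<bar> \<le> int (Suc n) \<longrightarrow> x i = y i" and y: "y \<in> sofic_shift G l"
        using that rho_less_iff[of x y "Suc n"] by auto
      have "rho (shift x) (shift y) < (1 / 2) ^ n"
        unfolding rho_less_iff shift_def by (intro allI impI xy[rule_format]) linarith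
      then show ?thesis using n x y by (auto intro: shift_in_sofic_shift)
    qed
    moreover have "x \<in> mball x ((1 / 2) ^ Suc n)" using x by auto
    ultimately show "\<exists>U. openin mtopology U \<and> x \<in> U \<and> (\<forall>y\<in>U. shift y \<in> mball (shift x) \<epsilon>)"
      by (intro exI[of _ "mball x ((1 / 2) ^ Suc n)"]) auto
  qed
qed

lemma compact_sofic_shift:
  assumes "finite (arcs G)"
  shows "compact_space (Metric_space.mtopology (sofic_shift G l) rho)"
proof -
  interpret Metric_space "sofic_shift G l" rho by (rule Metric_space_rho)
  let ?T = "product_topology (\<lambda>i::int. discrete_topology (arcs G)) UNIV"
  define W where "W = {e \<in> topspace ?T. \<forall>i. head G (e i) = tail G (e (i + 1))}"
  have compT: "compact_space ?T"
    using assms by (auto simp: compact_space_product_topology compact_space_discrete_topology)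
  have open_cyl: "openin ?T {e \<in> topspace ?T. e i \<in> S}" for i S
  proof -
    have "openin ?T {e \<in> topspace ?T. e i \<in> S \<inter> arcs G}"
      by (rule openin_continuous_map_preimage[OF continuous_map_product_projection]) auto
    moreover have "{e \<in> topspace ?T. e i \<in> S \<inter> arcs G} = {e \<in> topspace ?T. e i \<in> S}"
      by (auto simp: PiE_iff)
    ultimately show ?thesis by simp
  qed
  have "openin ?T (topspace ?T - W)"
  proof -
    have "topspace ?T - W =
      (\<Union>i. \<Union>a. {e \<in> topspace ?T. e i \<in> {a}} \<inter>
         {e \<in> topspace ?T. e (i + 1) \<in> {b. head G a \<noteq> tail G b}})"
      by (auto simp: W_def)
    also have "openin ?T \<dots>"
      by (intro openin_Union ballI openin_Int; elim imageE, hypsubst;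
          intro openin_Union ballI; elim imageE, hypsubst; intro openin_Int open_cyl)
    finally show ?thesis .
  qed
  then have "closedin ?T W" by (auto simp: closedin_def W_def)
  then have "compact_space (subtopology ?T W)"
    using compT closedin_compact_space compact_space_subtopology by blast
  moreover have "continuous_map (subtopology ?T W) mtopology (\<lambda>e i. l (e i))"
    unfolding continuous_map_to_metric
  proof (intro ballI allI impI)
    have inS: "(\<lambda>i. l (e i)) \<in> sofic_shift G l" if "e \<in> W" for e
      using that by (auto simp: W_def sofic_shift_def PiE_iff)
    fix e and \<epsilon> :: real
    assume "e \<in> topspace (subtopology ?T W)" and \<epsilon>: "\<epsilon> > 0"
    then have e: "e \<in> W" "e \<in> topspace ?T" by auto
    obtain n :: nat where n: "(1 / 2) ^ n < \<epsilon>" using power_half_less \<epsilon> by blast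
    define U where "U = (\<Inter>i\<in>{- int n..int n}. {f \<in> topspace ?T. f i \<in> {e i}})"
    have "openin ?T U"
      unfolding U_def by (intro openin_INT2 open_cyl) auto
    then have "openin (subtopology ?T W) (U \<inter> W)" by (rule openin_subtopology_Int)
    moreover have "e \<in> U \<inter> W" using e by (auto simp: U_def)
    moreover have "(\<lambda>i. l (f i)) \<in> mball (\<lambda>i. l (e i)) \<epsilon>" if "f \<in> U \<inter> W" for f
    proof -
      have "f i = e i" if "\<bar>i\<bar> \<le> int n" for i
        using \<open>f \<in> U \<inter> W\<close> that by (auto simp: U_def abs_le_iff)
      then have "rho (\<lambda>i. l (e i)) (\<lambda>i. l (f i)) < (1 / 2) ^ n"
        by (simp add: rho_less_iff)
      then show ?thesis using n inS e that by auto
    qed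
    ultimately show "\<exists>U. openin (subtopology ?T W) U \<and> e \<in> U \<and>
        (\<forall>f\<in>U. (\<lambda>i. l (f i)) \<in> mball (\<lambda>i. l (e i)) \<epsilon>)" by blast
  qed
  ultimately have "compactin mtopology ((\<lambda>e i. l (e i)) ` topspace (subtopology ?T W))"
    using image_compactin unfolding compact_space_def by blast
  moreover have "(\<lambda>e i. l (e i)) ` topspace (subtopology ?T W) = sofic_shift G l"
  proof -
    have "topspace (subtopology ?T W) = W" by (auto simp: W_def)
    moreover have "(\<lambda>e i. l (e i)) ` W = sofic_shift G l"
    proof (intro equalityI subsetI)
      fix x assume "x \<in> sofic_shift G l"
      then obtain e where
        e: "\<forall>i. e i \<in> arcs G \<and> head G (e i) = tail G (e (i + 1)) \<and> l (e i) = x i"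
        unfolding sofic_shift_def by blast
      then have "e \<in> W" "x = (\<lambda>i. l (e i))" by (auto simp: W_def)
      then show "x \<in> (\<lambda>e i. l (e i)) ` W" by blast
    qed (auto simp: W_def sofic_shift_def PiE_iff)
    ultimately show ?thesis by simp
  qed
  ultimately show ?thesis by (simp add: compact_space_def)
qed

theorem dynamical_system_sofic_shift:
  assumes "finite (arcs G)"
  shows "dynamical_system (sofic_shift G l) rho shift"
  by (intro dynamical_system.intro dynamical_system_axioms.intro Metric_space_rho
      compact_sofic_shift continuous_map_shift assms)

end

theory Submission
  imports Defs
begin

text \<open>
  Both halves rest on one dictionary (\<open>attractor_iff_words\<close>).  Being close to a shift-invariant
  set \<open>Y\<close> means carrying a long word of \<open>Y\<close> at the origin, so stability and attraction say: a point
  of \<open>\<Sigma>(G)\<close> that contains one sufficiently long word of \<open>Y\<close> has only words of \<open>Y\<close> (of a given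
  length) from some place on; for stability this place is independent of the point.  On the
  graph side, preimages of terminal subgraphs of the linking graph are exactly the vertex sets
  \<open>V\<close> that no arc leaves and that are closed under linking, and \<open>\<Omega>\<close> is the shift of the subgraph
  induced by \<open>V\<close>.

  Let \<open>V\<close> be such a set, and let two walks, one of them inside \<open>V\<close>, spell a common word of length
  \<open>|V(G)|\<^sup>2\<close>.  Their pair of current vertices repeats, and between the two visits both walks
  perform loops with equal labels.  Powers of these loops show that the two vertices are linked
  (\<open>loops_linked\<close>), so the other walk is in \<open>V\<close> by then and stays there.  Replacing its past by
  the loop turns its future into the future of a point of \<open>\<Omega>\<close> (\<open>long_common_word_traps\<close>).
  Hence after one such word all further words are words of \<open>\<Omega>\<close>, which is the attractor property.

  Conversely let \<open>Y\<close> be an attractor and \<open>n\<close> a length such that a word of \<open>Y\<close> of length \<open>n\<close>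
  forces convergence to \<open>Y\<close>.  Call a vertex captured if some walk that starts with such a word
  ends there.  Appending to this walk a loop, repeated forever, and choosing any past (here
  essentiality enters), one obtains a point converging to \<open>Y\<close>; so labels of loops at captured
  vertices are words of \<open>Y\<close> (\<open>captured_loop\<close>).  It follows that captured vertices are closed
  under linking, because a long common word of linked vertices is part of a loop at the captured
  one (\<open>captured_linked\<close>), and that \<open>Y\<close> is the shift of the subgraph they induce
  (\<open>attractor_eq\<close>).
\<close>

section \<open>Biinfinite walks and their words\<close>

definition biwalk :: "('v, 'e) pre_digraph \<Rightarrow> (int \<Rightarrow> 'e) \<Rightarrow> bool" where
  "biwalk G e \<longleftrightarrow> (\<forall>i. e i \<in> arcs G \<and> head G (e i) = tail G (e (i + 1)))"

lemma sofic_shift_eq: "sofic_shift G l = {\<lambda>i. l (e i) | e. biwalk G e}"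
  by (auto simp: sofic_shift_def biwalk_def fun_eq_iff) metis+

lemma biwalk_translate:
  assumes "biwalk G e"
  shows "biwalk G (\<lambda>i. e (i + k))"
  using assms by (simp add: biwalk_def add.assoc add.commute[of 1])

lemma sofic_shift_translate: "x \<in> sofic_shift G l \<Longrightarrow> (\<lambda>i. x (i + k)) \<in> sofic_shift G l"
  unfolding sofic_shift_eq by (force dest: biwalk_translate)

lemma funpow_shift: "(shift ^^ n) x = (\<lambda>i. x (i + int n))"
  by (induction n) (auto simp: shift_def algebra_simps fun_eq_iff)

definition factor :: "(int \<Rightarrow> 'b) \<Rightarrow> int \<Rightarrow> nat \<Rightarrow> 'b list" where
  "factor x a n = map (\<lambda>k. x (a + int k)) [0..<n]"

definition language :: "(int \<Rightarrow> 'b) set \<Rightarrow> 'b list set" where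
  "language Y = {factor y a n | y a n. y \<in> Y}"

lemma length_factor [simp]: "length (factor x a n) = n"
  by (simp add: factor_def)

lemma nth_factor [simp]: "k < n \<Longrightarrow> factor x a n ! k = x (a + int k)"
  by (simp add: factor_def)

lemma factor_eq_iff: "factor x a n = factor y b n \<longleftrightarrow> (\<forall>k<n. x (a + int k) = y (b + int k))"
  by (auto simp: list_eq_iff_nth_eq)

lemma map_factor: "map l (factor e a n) = factor (\<lambda>i. l (e i)) a n"
  by (simp add: factor_def)

lemma factor_in_languageI: "y \<in> Y \<Longrightarrow> factor y a n \<in> language Y"
  by (auto simp: language_def)

lemma factor_in_languageE:
  assumes "factor x a n \<in> language Y"
  obtains y b where "y \<in> Y" "\<And>k. k < n \<Longrightarrow> x (a + int k) = y (b + int k)"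
proof -
  obtain y b m where y: "y \<in> Y" "factor x a n = factor y b m"
    using assms by (auto simp: language_def)
  then have "m = n" by (metis length_factor)
  then show ?thesis using y that[of y b] by (auto simp: factor_eq_iff)
qed

lemma factor_in_language_mono:
  assumes "factor x a m \<in> language Y" "a \<le> b" "b + int n \<le> a + int m"
  shows "factor x b n \<in> language Y"
proof -
  obtain y c where y: "y \<in> Y" "\<And>k. k < m \<Longrightarrow> x (a + int k) = y (c + int k)"
    using factor_in_languageE assms(1) by metis
  have "x (b + int k) = y (c + (b - a) + int k)" if "k < n" for k
    using y(2)[of "nat (b - a) + k"] that assms(2,3) by (auto simp: algebra_simps)
  then have "factor x b n = factor y (c + (b - a)) n" by (simp add: factor_eq_iff)
  then show ?thesis using y(1) factor_in_languageI by metis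
qed

text \<open>A ray that returns to its initial vertex can be continued into the past by running
  backwards around that loop, without leaving the arcs of the ray.  This is how rays inside an
  induced subgraph, whose vertices need not have predecessors there, become points of its shift.\<close>

lemma periodic_past:
  fixes e :: "int \<Rightarrow> 'e"
  assumes ray: "\<And>k. k \<ge> i \<Longrightarrow> e k \<in> arcs G \<and> head G (e k) = tail G (e (k + 1))"
    and loop: "i < j" "tail G (e i) = tail G (e j)"
  obtains e' where "biwalk G e'" "\<And>k. k \<ge> i \<Longrightarrow> e' k = e k"
proof
  \<comment> \<open>the time in \<open>{i..<j}\<close> that is congruent to \<open>k\<close> modulo the length of the loop\<close>
  define r where "r k = i + (k - i) mod (j - i)" for k
  define e' where "e' k = (if k \<ge> i then e k else e (r k))" for k
  have r: "r k \<ge> i" "r k < j" for k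
    using loop(1) pos_mod_sign[of "j - i" "k - i"] pos_mod_bound[of "j - i" "k - i"]
    unfolding r_def by linarith+
  have step: "r (k + 1) = (if r k + 1 = j then i else r k + 1)" for k
  proof -
    have "(k + 1 - i) mod (j - i) = ((k - i) mod (j - i) + 1) mod (j - i)"
      using mod_add_left_eq[of "k - i" "j - i" 1] by (simp add: add_diff_eq diff_add_eq)
    also have "\<dots> = (if (k - i) mod (j - i) + 1 = j - i then 0 else (k - i) mod (j - i) + 1)"
      using r[of k] loop(1) by (auto simp: r_def intro!: mod_pos_pos_trivial)
    finally show ?thesis by (auto simp: r_def)
  qed
  have ri: "r i = i" by (simp add: r_def)
  have tl: "tail G (e (r (k + 1))) = tail G (e (r k + 1))" for k
    using loop(2) by (simp add: step)
  have "e' k \<in> arcs G \<and> head G (e' k) = tail G (e' (k + 1))" for k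
  proof (cases "k \<ge> i")
    case True
    then show ?thesis using ray by (simp add: e'_def)
  next
    case False
    then have "tail G (e' (k + 1)) = tail G (e (r (k + 1)))"
      using ri by (cases "k + 1 = i") (auto simp: e'_def)
    then show ?thesis using False ray[OF r(1)[of k]] tl[of k] by (simp add: e'_def)
  qed
  then show "biwalk G e'" by (simp add: biwalk_def)
  show "e' k = e k" if "k \<ge> i" for k using that by (simp add: e'_def)
qed

lemma finite_revisit:
  fixes f :: "int \<Rightarrow> 'b"
  assumes "finite A" "\<And>k. k \<ge> a \<Longrightarrow> f k \<in> A"
  obtains i j where "a \<le> i" "i < j" "j \<le> a + int (card A)" "f i = f j"
proof -
  have "\<not> inj_on f {a..a + int (card A)}"
  proof
    assume "inj_on f {a..a + int (card A)}"
    then have "card {a..a + int (card A)} \<le> card A"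
      using assms by (intro card_inj_on_le[of f]) auto
    then show False by simp
  qed
  then obtain i j where "i \<in> {a..a + int (card A)}" "j \<in> {a..a + int (card A)}" "i \<noteq> j" "f i = f j"
    unfolding inj_on_def by blast
  then show ?thesis by (cases "i < j") (auto intro: that[of i j] that[of j i])
qed

lemma awalk_segment:
  assumes "wf_digraph G"
    and "\<And>k. k \<ge> i \<Longrightarrow> e k \<in> arcs G \<and> head G (e k) = tail G (e (k + 1))"
  shows "pre_digraph.awalk G (tail G (e i)) (factor e i n) (tail G (e (i + int n)))"
proof -
  interpret wf_digraph G by fact
  show ?thesis
  proof (induction n)
    case 0
    then show ?case using assms(2)[of i] by (simp add: factor_def awalk_Nil_iff)
  next
    case (Suc n)
    have "awalk (tail G (e (i + int n))) [e (i + int n)] (tail G (e (i + int (Suc n))))"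
      using assms(2)[of "i + int n"] assms(2)[of "i + int n + 1"] by (auto simp: awalk_simps algebra_simps)
    from awalk_appendI[OF Suc this] show ?case by (simp add: factor_def)
  qed
qed

lemma (in pre_digraph) cas_nth:
  "cas u p v \<Longrightarrow> Suc k < length p \<Longrightarrow> head G (p ! k) = tail G (p ! Suc k)"
proof (induction u p v arbitrary: k rule: cas.induct)
  case (2 u e es v)
  then show ?case by (cases k; cases es) auto
qed simp

lemma (in pre_digraph) cas_nth_ends:
  assumes "cas u p v" "p \<noteq> []"
  shows "tail G (p ! 0) = u" "head G (p ! (length p - 1)) = v"
proof -
  show "tail G (p ! 0) = u" using assms by (cases p) auto
  show "head G (p ! (length p - 1)) = v" using assms
  proof (induction u p v rule: cas.induct)
    case (2 u e es v)
    then show ?case by (cases es) auto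
  qed simp
qed

text \<open>The lasso \<open>p c c c \<dots>\<close>.  In an essential graph it extends to the past through
  arbitrarily chosen incoming arcs, so it occurs as the future of a point of the shift.\<close>

lemma (in wf_digraph) lasso_biwalk:
  assumes ess: "essential G" and p: "awalk u p v" and c: "awalk v c v" "c \<noteq> []"
  obtains e where "biwalk G e" "\<And>k. k < length p \<Longrightarrow> e (int k) = p ! k"
    "\<And>n k. k < length c \<Longrightarrow> e (int (length p + n * length c + k)) = c ! k"
proof -
  define g where "g w = (SOME a. a \<in> in_arcs G w)" for w
  have g: "g w \<in> arcs G" "head G (g w) = w" if "w \<in> verts G" for w
  proof -
    have "\<exists>a. a \<in> in_arcs G w" using ess that unfolding essential_def by blast
    then have "g w \<in> in_arcs G w" unfolding g_def by (rule someI_ex)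
    then show "g w \<in> arcs G" "head G (g w) = w" by auto
  qed
  define V where "V n = ((\<lambda>w. tail G (g w)) ^^ n) u" for n
  have V_Suc: "V (Suc n) = tail G (g (V n))" for n by (simp add: V_def)
  have V: "V n \<in> verts G" for n
    using p g by (induction n) (auto simp: V_def)
  define R where "R k = (if k < length p then p ! k else c ! ((k - length p) mod length c))" for k
  have ap: "set p \<subseteq> arcs G" "cas u p v" "set c \<subseteq> arcs G" "cas v c v" using p c by auto
  have R0: "tail G (R 0) = u"
    using cas_nth_ends[OF ap(2)] cas_nth_ends[OF ap(4) c(2)] ap(2) by (cases p) (auto simp: R_def)
  have Ra: "R k \<in> arcs G" for k
    using ap c(2) by (auto simp: R_def subset_iff)
  have Rs: "head G (R k) = tail G (R (Suc k))" for k
  proof -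
    consider "Suc k < length p" | "Suc k = length p" | "k \<ge> length p" by linarith
    then show ?thesis
    proof cases
      case 1
      then show ?thesis using cas_nth[OF ap(2)] by (simp add: R_def)
    next
      case 2
      then show ?thesis using cas_nth_ends(2)[OF ap(2)] cas_nth_ends(1)[OF ap(4) c(2)]
        by (cases p) (auto simp: R_def)
    next
      case 3
      let ?m = "(k - length p) mod length c"
      have m: "?m < length c" using c(2) by simp
      have "Suc k - length p = Suc (k - length p)" using 3 by simp
      then have "(Suc k - length p) mod length c = (if Suc ?m = length c then 0 else Suc ?m)"
        by (simp add: mod_Suc)
      moreover have "Suc ?m = length c \<Longrightarrow> ?m = length c - 1" by simp
      ultimately show ?thesis
        using 3 m cas_nth[OF ap(4), of ?m] cas_nth_ends[OF ap(4) c(2)]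
        by (auto simp: R_def)
    qed
  qed
  define e where "e i = (if i \<ge> 0 then R (nat i) else g (V (nat (- i - 1))))" for i :: int
  show ?thesis
  proof
    have "e i \<in> arcs G \<and> head G (e i) = tail G (e (i + 1))" for i
    proof -
      consider "i \<ge> 0" | "i = -1" | "i < -1" by linarith
      then show ?thesis
      proof cases
        case 1
        then show ?thesis using Ra Rs[of "nat i"] by (simp add: e_def nat_add_distrib)
      next
        case 2
        then show ?thesis using g[OF V[of 0]] R0 by (simp add: e_def V_def)
      next
        case 3
        then have "nat (- i - 1) = Suc (nat (- (i + 1) - 1))" by linarith
        then show ?thesis using 3 g[OF V] by (simp add: e_def flip: V_Suc)
      qed
    qed
    then show "biwalk G e" by (simp add: biwalk_def)
    show "e (int k) = p ! k" if "k < length p" for k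
      using that by (simp add: e_def R_def)
    show "e (int (length p + n * length c + k)) = c ! k" if "k < length c" for n k
    proof -
      have "(n * length c + k) mod length c = k" using that by simp
      then show ?thesis unfolding e_def R_def
        by (simp add: add.assoc flip: of_nat_add of_nat_mult)
    qed
  qed
qed

section \<open>Linked vertices\<close>

lemma sym_linked: "sym (linked G l)"
  by (auto simp: sym_def linked_def Int_commute)

lemma link_class_eq: "(v, w) \<in> (linked G l)\<^sup>* \<Longrightarrow> link_class G l v = link_class G l w"
  using sym_rtrancl[OF sym_linked, of G l] unfolding link_class_def
  by (auto dest: symD intro: rtrancl_trans)

text \<open>Two loops with the same label sequence link their base vertices, because every repetition
  of the loops is again a common label.\<close>

lemma (in wf_digraph) loops_linked:
  assumes p: "awalk v p v" and q: "awalk w q w" and "map l p = map l q" "p \<noteq> []"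
  shows "(v, w) \<in> linked G l"
proof -
  have follower: "map l (concat (replicate n c)) \<in> restricted_follower_set G l u"
    if c: "awalk u c u" for u c n
  proof -
    have u: "u \<in> verts G" using c by auto
    have scc: "scc_of u \<in> sccs_verts" "u \<in> scc_of u"
      using scc_of_in_sccs_verts in_scc_of_self u by auto
    let ?K = "G \<restriction> scc_of u"
    have cn: "awalk u (concat (replicate n c)) u"
      using u c by (induction n) (auto simp: awalk_Nil_iff intro: awalk_appendI)
    have "tail G a \<in> scc_of u \<and> head G a \<in> scc_of u" if "a \<in> set (concat (replicate n c))" for a
    proof -
      have "tail G a \<in> set (awalk_verts u (concat (replicate n c)))"
        "head G a \<in> set (awalk_verts u (concat (replicate n c)))"
        using that cn by (auto simp: set_awalk_verts)
      then show ?thesis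
        using awalk_verts_reachable_from[OF cn] awalk_verts_reachable_to[OF cn]
        by (auto simp: scc_of_def)
    qed
    then have "pre_digraph.awalk ?K u (concat (replicate n c)) u"
      using cn scc by (auto simp: pre_digraph.awalk_def compatible_cas[OF compatible_induce_subgraph])
    moreover have "?K \<in> sccs" using in_verts_sccsD_sccs scc by blast
    moreover have "u \<in> verts ?K" using scc(2) by simp
    ultimately show ?thesis unfolding restricted_follower_set_def by blast
  qed
  let ?s = "\<lambda>n. concat (replicate n (map l p))"
  have "range ?s \<subseteq> restricted_follower_set G l v \<inter> restricted_follower_set G l w"
  proof (rule image_subsetI)
    show "?s n \<in> restricted_follower_set G l v \<inter> restricted_follower_set G l w" for n
      using follower[OF p, of n] follower[OF q, of n] assms(3) by (simp add: map_concat)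
  qed
  moreover have "inj ?s"
  proof (rule injI)
    fix m n assume "?s m = ?s n"
    then have "length (?s m) = length (?s n)" by simp
    then have "m * length p = n * length p" by (simp add: length_concat sum_list_replicate)
    then show "m = n" using assms(4) by simp
  qed
  ultimately have "infinite (restricted_follower_set G l v \<inter> restricted_follower_set G l w)"
    by (meson finite_subset range_inj_infinite)
  then show ?thesis using p q by (auto simp: linked_def)
qed

section \<open>Attractors of shift spaces in terms of words\<close>

lemma point_set_dist_less_iff:
  assumes "Y \<noteq> {}"
  shows "point_set_dist rho x Y < (1 / 2) ^ n \<longleftrightarrow> (\<exists>y\<in>Y. \<forall>i. \<bar>i\<bar> \<le> int n \<longrightarrow> x i = y i)"
proof -
  have "bdd_below (rho x ` Y)" by (rule bdd_belowI[of _ 0]) (auto simp: rho_def)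
  then show ?thesis
    unfolding point_set_dist_def using assms by (simp add: cINF_less_iff rho_less_iff)
qed

lemma point_set_dist_nonneg: "Y \<noteq> {} \<Longrightarrow> 0 \<le> point_set_dist rho x Y"
  unfolding point_set_dist_def by (rule cINF_greatest) (auto simp: rho_def)

lemma point_set_dist_translate_less_iff:
  assumes "Y \<noteq> {}" and inv: "\<And>y k. y \<in> Y \<Longrightarrow> (\<lambda>i. y (i + k)) \<in> Y"
  shows "point_set_dist rho (\<lambda>i. x (i + c)) Y < (1 / 2) ^ n \<longleftrightarrow>
    factor x (c - int n) (2 * n + 1) \<in> language Y"
  unfolding point_set_dist_less_iff[OF assms(1)]
proof
  assume "\<exists>y\<in>Y. \<forall>i. \<bar>i\<bar> \<le> int n \<longrightarrow> x (i + c) = y i"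
  then obtain y where y: "y \<in> Y" "\<And>i. \<bar>i\<bar> \<le> int n \<Longrightarrow> x (i + c) = y i" by blast
  have "x (c - int n + int k) = y (- int n + int k)" if "k < 2 * n + 1" for k
    using y(2)[of "- int n + int k"] that by (simp add: algebra_simps)
  then have "factor x (c - int n) (2 * n + 1) = factor y (- int n) (2 * n + 1)"
    unfolding factor_eq_iff by blast
  then show "factor x (c - int n) (2 * n + 1) \<in> language Y"
    using y(1) factor_in_languageI by metis
next
  assume "factor x (c - int n) (2 * n + 1) \<in> language Y"
  then obtain y b where y: "y \<in> Y"
      "\<And>k. k < 2 * n + 1 \<Longrightarrow> x (c - int n + int k) = y (b + int k)"
    using factor_in_languageE by metis
  have "x (i + c) = y (i + (b + int n))" if "\<bar>i\<bar> \<le> int n" for i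
  proof -
    have "nat (i + int n) < 2 * n + 1" "int (nat (i + int n)) = i + int n" using that by auto
    then show ?thesis using y(2)[of "nat (i + int n)"] by (simp add: algebra_simps)
  qed
  then show "\<exists>y\<in>Y. \<forall>i. \<bar>i\<bar> \<le> int n \<longrightarrow> x (i + c) = y i"
    using inv[OF y(1)] by (intro bexI[of _ "\<lambda>i. y (i + (b + int n))"]) auto
qed

lemma invariant_translate:
  assumes "shift ` Y = Y" "y \<in> Y"
  shows "(\<lambda>i. y (i + k)) \<in> Y"
proof -
  have img: "(shift ^^ n) ` Y = Y" for n
  proof (induction n)
    case (Suc n)
    have "(shift ^^ Suc n) ` Y = shift ` (shift ^^ n) ` Y" by (simp add: image_comp)
    then show ?case using Suc assms(1) by simp
  qed simp
  show ?thesis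
  proof (cases "k \<ge> 0")
    case True
    then have "(\<lambda>i. y (i + k)) = (shift ^^ nat k) y" by (simp add: funpow_shift)
    then show ?thesis using img[of "nat k"] assms(2) by blast
  next
    case False
    obtain y' where "y' \<in> Y" "y = (shift ^^ nat (- k)) y'"
      using img[of "nat (- k)"] assms(2) by blast
    then show ?thesis using False by (simp add: funpow_shift)
  qed
qed

text \<open>Closeness to \<open>Y\<close> means carrying a long word of \<open>Y\<close> around the origin.  Since
  everything is translation invariant, the position of that word is immaterial, and the two
  asymptotic conditions become statements about which words occur to the right of a given one.\<close>

lemma attractor_iff_words:
  assumes ds: "dynamical_system X rho shift"
    and X: "\<And>x k. x \<in> X \<Longrightarrow> (\<lambda>i. x (i + k)) \<in> X"
  shows "dynamical_system.attractor X rho shift Y \<longleftrightarrow>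
     Y \<noteq> {} \<and> closedin (Metric_space.mtopology X rho) Y \<and> shift ` Y = Y \<and>
     (\<forall>m. \<exists>n. \<forall>x\<in>X. \<forall>a. factor x a n \<in> language Y \<longrightarrow>
        (\<forall>b\<ge>a + int n. factor x b m \<in> language Y)) \<and>
     (\<exists>n. \<forall>x\<in>X. \<forall>a. factor x a n \<in> language Y \<longrightarrow>
        (\<forall>m. \<exists>c. \<forall>b\<ge>c. factor x b m \<in> language Y))"
    (is "_ \<longleftrightarrow> _ \<and> _ \<and> _ \<and> ?stable \<and> ?limit")
proof -
  interpret dynamical_system X rho shift by fact
  let ?D = "\<lambda>x. point_set_dist rho x Y"
  have "((\<forall>\<epsilon>>0. \<exists>\<delta>>0. \<forall>x\<in>X. ?D x < \<delta> \<longrightarrow> (\<forall>n>0. ?D ((shift ^^ n) x) < \<epsilon>)) \<longleftrightarrow> ?stable) \<and>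
      ((\<exists>\<delta>>0. \<forall>x\<in>X. ?D x < \<delta> \<longrightarrow> (\<lambda>n. ?D ((shift ^^ n) x)) \<longlonglongrightarrow> 0) \<longleftrightarrow> ?limit)"
    (is "(?stable' \<longleftrightarrow> _) \<and> (?limit' \<longleftrightarrow> _)")
    if ne: "Y \<noteq> {}" and sY: "shift ` Y = Y"
  proof (intro conjI iffI)
    note D = point_set_dist_translate_less_iff[OF ne invariant_translate[OF sY]]
    have D0: "?D x < (1 / 2) ^ n \<longleftrightarrow> factor x (- int n) (2 * n + 1) \<in> language Y" for x n
      using D[of x 0 n] by simp
    have near: "\<exists>N. \<forall>x a. factor x a (2 * N + 1) \<in> language Y \<longrightarrow> ?D (\<lambda>i. x (i + (a + int N))) < \<delta>"
      if \<delta>: "\<delta> > 0" for \<delta>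
    proof -
      obtain N :: nat where N: "(1 / 2) ^ N < \<delta>" using power_half_less \<delta> by blast
      show ?thesis
      proof (intro exI[of _ N] allI impI)
        fix x a assume "factor x a (2 * N + 1) \<in> language Y"
        then have "?D (\<lambda>i. x (i + (a + int N))) < (1 / 2) ^ N"
          using D[of x "a + int N" N] by simp
        then show "?D (\<lambda>i. x (i + (a + int N))) < \<delta>" using N by linarith
      qed
    qed
    have far: "factor x (c + int n) m \<in> language Y"
      if "?D ((shift ^^ n) (\<lambda>i. x (i + c))) < (1 / 2) ^ m" for x c n m
    proof -
      have "(shift ^^ n) (\<lambda>i. x (i + c)) = (\<lambda>i. x (i + (c + int n)))"
        by (simp add: funpow_shift algebra_simps)
      then have "factor x (c + int n - int m) (2 * m + 1) \<in> language Y" using that D by metis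
      then show ?thesis by (rule factor_in_language_mono) auto
    qed
    show ?stable
      if S: "\<forall>\<epsilon>>0. \<exists>\<delta>>0. \<forall>x\<in>X. ?D x < \<delta> \<longrightarrow> (\<forall>n>0. ?D ((shift ^^ n) x) < \<epsilon>)"
    proof
      fix m :: nat
      have "(1 / 2 :: real) ^ m > 0" by simp
      then obtain \<delta> where \<delta>: "\<delta> > 0"
          "\<forall>x\<in>X. ?D x < \<delta> \<longrightarrow> (\<forall>n>0. ?D ((shift ^^ n) x) < (1 / 2) ^ m)"
        using S by blast
      obtain N where N: "\<And>x a. factor x a (2 * N + 1) \<in> language Y \<Longrightarrow> ?D (\<lambda>i. x (i + (a + int N))) < \<delta>"
        using near[OF \<delta>(1)] by blast
      show "\<exists>n. \<forall>x\<in>X. \<forall>a. factor x a n \<in> language Y \<longrightarrow>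
          (\<forall>b\<ge>a + int n. factor x b m \<in> language Y)"
      proof (intro exI[of _ "2 * N + 1"] ballI allI impI)
        fix x a b assume x: "x \<in> X" "factor x a (2 * N + 1) \<in> language Y" and b: "b \<ge> a + int (2 * N + 1)"
        let ?n = "nat (b - (a + int N))"
        have "?n > 0" using b by auto
        then have "?D ((shift ^^ ?n) (\<lambda>i. x (i + (a + int N)))) < (1 / 2) ^ m"
          using \<delta>(2) X[OF x(1)] N[OF x(2)] by blast
        then have "factor x (a + int N + int ?n) m \<in> language Y" by (rule far)
        moreover have "a + int N + int ?n = b" using b by auto
        ultimately show "factor x b m \<in> language Y" by simp
      qed
    qed
    show ?limit if "\<exists>\<delta>>0. \<forall>x\<in>X. ?D x < \<delta> \<longrightarrow> (\<lambda>n. ?D ((shift ^^ n) x)) \<longlonglongrightarrow> 0"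
    proof -
      obtain \<delta> where \<delta>: "\<delta> > 0" "\<forall>x\<in>X. ?D x < \<delta> \<longrightarrow> (\<lambda>n. ?D ((shift ^^ n) x)) \<longlonglongrightarrow> 0"
        using \<open>\<exists>\<delta>>0. \<forall>x\<in>X. ?D x < \<delta> \<longrightarrow> (\<lambda>n. ?D ((shift ^^ n) x)) \<longlonglongrightarrow> 0\<close> by blast
      obtain N where N: "\<And>x a. factor x a (2 * N + 1) \<in> language Y \<Longrightarrow> ?D (\<lambda>i. x (i + (a + int N))) < \<delta>"
        using near[OF \<delta>(1)] by blast
      show ?thesis
      proof (intro exI[of _ "2 * N + 1"] ballI allI impI)
        fix x a m assume x: "x \<in> X" "factor x a (2 * N + 1) \<in> language Y"
        have "(\<lambda>n. ?D ((shift ^^ n) (\<lambda>i. x (i + (a + int N))))) \<longlonglongrightarrow> 0"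
          using \<delta>(2) X[OF x(1)] N[OF x(2)] by blast
        then have "\<forall>\<^sub>F n in sequentially. ?D ((shift ^^ n) (\<lambda>i. x (i + (a + int N)))) < (1 / 2) ^ m"
          by (rule order_tendstoD) simp
        then obtain n0 where n0: "\<And>n. n \<ge> n0 \<Longrightarrow> ?D ((shift ^^ n) (\<lambda>i. x (i + (a + int N)))) < (1 / 2) ^ m"
          unfolding eventually_sequentially by blast
        show "\<exists>c. \<forall>b\<ge>c. factor x b m \<in> language Y"
        proof (intro exI[of _ "a + int N + int n0"] allI impI)
          fix b assume b: "b \<ge> a + int N + int n0"
          then have "nat (b - (a + int N)) \<ge> n0" by auto
          then have "factor x (a + int N + int (nat (b - (a + int N)))) m \<in> language Y"
            by (intro far n0)
          moreover have "a + int N + int (nat (b - (a + int N))) = b" using b by auto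
          ultimately show "factor x b m \<in> language Y" by simp
        qed
      qed
    qed
    have D_shift: "?D ((shift ^^ n) x) < (1 / 2) ^ m"
      if "factor x (int n - int m) (2 * m + 1) \<in> language Y" for x n m
      using that D[of x "int n" m] by (simp add: funpow_shift)
    show "\<forall>\<epsilon>>0. \<exists>\<delta>>0. \<forall>x\<in>X. ?D x < \<delta> \<longrightarrow> (\<forall>n>0. ?D ((shift ^^ n) x) < \<epsilon>)" if S: ?stable
    proof (intro allI impI)
      fix \<epsilon> :: real assume "\<epsilon> > 0"
      then obtain m :: nat where m: "(1 / 2) ^ m < \<epsilon>" using power_half_less by blast
      obtain W where W: "\<And>x a b. x \<in> X \<Longrightarrow> factor x a W \<in> language Y \<Longrightarrow> b \<ge> a + int W \<Longrightarrow>
          factor x b (2 * m + 1) \<in> language Y"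
        using S by metis
      show "\<exists>\<delta>>0. \<forall>x\<in>X. ?D x < \<delta> \<longrightarrow> (\<forall>n>0. ?D ((shift ^^ n) x) < \<epsilon>)"
      proof (intro exI[of _ "(1 / 2) ^ (m + W)"] conjI ballI impI allI)
        fix x n assume x: "x \<in> X" "?D x < (1 / 2) ^ (m + W)"
        have "factor x (- int (m + W)) W \<in> language Y"
          using x(2) unfolding D0 by (rule factor_in_language_mono) auto
        then have "factor x (int n - int m) (2 * m + 1) \<in> language Y" by (intro W[OF x(1)]) auto
        then show "?D ((shift ^^ n) x) < \<epsilon>" using D_shift m by (meson less_trans)
      qed simp
    qed
    show "\<exists>\<delta>>0. \<forall>x\<in>X. ?D x < \<delta> \<longrightarrow> (\<lambda>n. ?D ((shift ^^ n) x)) \<longlonglongrightarrow> 0" if L: ?limit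
    proof -
      obtain W where W: "\<And>x a m. x \<in> X \<Longrightarrow> factor x a W \<in> language Y \<Longrightarrow>
          \<exists>c. \<forall>b\<ge>c. factor x b m \<in> language Y"
        using L by metis
      show ?thesis
      proof (intro exI[of _ "(1 / 2) ^ W"] conjI ballI impI)
        fix x assume x: "x \<in> X" "?D x < (1 / 2) ^ W"
        have fW: "factor x (- int W) W \<in> language Y"
          using x(2) unfolding D0 by (rule factor_in_language_mono) auto
        show "(\<lambda>n. ?D ((shift ^^ n) x)) \<longlonglongrightarrow> 0"
        proof (rule LIMSEQ_I)
          fix \<epsilon> :: real assume "\<epsilon> > 0"
          then obtain m :: nat where m: "(1 / 2) ^ m < \<epsilon>" using power_half_less by blast
          obtain c where c: "\<And>b. b \<ge> c \<Longrightarrow> factor x b (2 * m + 1) \<in> language Y"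
            using W[OF x(1) fW] by blast
          show "\<exists>n0. \<forall>n\<ge>n0. norm (?D ((shift ^^ n) x) - 0) < \<epsilon>"
          proof (intro exI[of _ "nat c + m"] allI impI)
            fix n assume "n \<ge> nat c + m"
            then have "?D ((shift ^^ n) x) < (1 / 2) ^ m" by (intro D_shift c) linarith
            then show "norm (?D ((shift ^^ n) x) - 0) < \<epsilon>"
              using m point_set_dist_nonneg[OF ne, of "(shift ^^ n) x"] by simp
          qed
        qed
      qed simp
    qed
  qed
  note words = this
  show ?thesis
  proof (cases "Y \<noteq> {} \<and> shift ` Y = Y")
    case True
    then have eqs: "?stable' = ?stable" "?limit' = ?limit" using words by auto
    show ?thesis unfolding attractor_def eqs by (rule refl)
  next
    have vacuous: "(A \<and> C \<and> B \<and> P) = (A \<and> C \<and> B \<and> Q)" if "\<not> (A \<and> B)" for A B C P Q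
      using that by blast
    case False
    then show ?thesis unfolding attractor_def by (rule vacuous)
  qed
qed

lemma (in fin_digraph) sofic_attractor_iff_words:
  "dynamical_system.attractor (sofic_shift G l) rho shift Y \<longleftrightarrow>
     Y \<noteq> {} \<and> closedin (Metric_space.mtopology (sofic_shift G l) rho) Y \<and> shift ` Y = Y \<and>
     (\<forall>m. \<exists>n. \<forall>x\<in>sofic_shift G l. \<forall>a. factor x a n \<in> language Y \<longrightarrow>
        (\<forall>b\<ge>a + int n. factor x b m \<in> language Y)) \<and>
     (\<exists>n. \<forall>x\<in>sofic_shift G l. \<forall>a. factor x a n \<in> language Y \<longrightarrow>
        (\<forall>m. \<exists>c. \<forall>b\<ge>c. factor x b m \<in> language Y))"
  by (intro attractor_iff_words dynamical_system_sofic_shift finite_arcs sofic_shift_translate)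

section \<open>Link-closed, forward-closed vertex sets give attractors\<close>

text \<open>The window is as long as the number of vertex pairs, so that the pair of current vertices of
  two walks spelling the common word must repeat.  One repetition does two jobs: the loops
  between the two visits link the vertices, which puts the first walk into \<open>V\<close> for good, and the
  first walk's own loop serves as its new past inside \<open>V\<close>.\<close>

lemma (in fin_digraph) long_common_word_traps:
  assumes closed: "\<And>e. e \<in> arcs G \<Longrightarrow> tail G e \<in> V \<Longrightarrow> head G e \<in> V"
    and linked: "\<And>v w. (v, w) \<in> linked G l \<Longrightarrow> v \<in> V \<Longrightarrow> w \<in> V"
    and x: "x \<in> sofic_shift G l"
    and word: "factor x a (card (verts G \<times> verts G)) \<in> language (sofic_shift (G \<restriction> V) l)"
  obtains z where "z \<in> sofic_shift (G \<restriction> V) l"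
    "\<And>k. k \<ge> a + int (card (verts G \<times> verts G)) \<Longrightarrow> z k = x k"
proof -
  let ?L = "card (verts G \<times> verts G)"
  obtain y b where y: "y \<in> sofic_shift (G \<restriction> V) l"
      "\<And>k. k < ?L \<Longrightarrow> x (a + int k) = y (b + int k)"
    using factor_in_languageE word by metis
  obtain e where e: "biwalk G e" "x = (\<lambda>i. l (e i))" using x by (auto simp: sofic_shift_eq)
  obtain f0 where f0: "biwalk (G \<restriction> V) f0" "y = (\<lambda>i. l (f0 i))"
    using y(1) by (auto simp: sofic_shift_eq)
  define f where "f i = f0 (i + (b - a))" for i
  have "biwalk (G \<restriction> V) f" unfolding f_def by (rule biwalk_translate[OF f0(1)])
  then have f: "biwalk G f" "\<And>i. tail G (f i) \<in> V" by (auto simp: biwalk_def)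
  have lab: "l (e i) = l (f i)" if "a \<le> i" "i < a + int ?L" for i
  proof -
    have "x (a + int (nat (i - a))) = y (b + int (nat (i - a)))" using that by (intro y(2)) linarith
    moreover have "a + int (nat (i - a)) = i" "b + int (nat (i - a)) = i + (b - a)"
      using that by auto
    ultimately show ?thesis by (simp only: e(2) f0(2) f_def)
  qed
  have steps: "e k \<in> arcs G \<and> head G (e k) = tail G (e (k + 1))"
      "f k \<in> arcs G \<and> head G (f k) = tail G (f (k + 1))" for k
    using e(1) f(1) by (auto simp: biwalk_def)
  have "(tail G (e k), tail G (f k)) \<in> verts G \<times> verts G" for k using steps by auto
  then obtain i j where ij: "a \<le> i" "i < j" "j \<le> a + int ?L"
      "(tail G (e i), tail G (f i)) = (tail G (e j), tail G (f j))"
    using finite_revisit[of "verts G \<times> verts G" a "\<lambda>k. (tail G (e k), tail G (f k))"] by auto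
  define n where "n = nat (j - i)"
  have n: "i + int n = j" "n > 0" using ij(2) by (auto simp: n_def)
  have "awalk (tail G (e i)) (factor e i n) (tail G (e i))"
      "awalk (tail G (f i)) (factor f i n) (tail G (f i))"
    using awalk_segment[OF wf_digraph_axioms, of i e n]
      awalk_segment[OF wf_digraph_axioms, of i f n] steps n ij(4) by auto
  moreover have "map l (factor f i n) = map l (factor e i n)"
    unfolding map_factor factor_eq_iff using lab ij n by auto
  moreover have "factor f i n \<noteq> []" using n(2) by (metis length_factor list.size(3) less_irrefl)
  ultimately have "(tail G (f i), tail G (e i)) \<in> linked G l" by (intro loops_linked)
  then have i: "tail G (e i) \<in> V" using linked f(2) by blast
  have inV: "tail G (e k) \<in> V" if "k \<ge> i" for k
    using that
  proof (induction k rule: int_ge_induct)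
    case base
    show ?case by (rule i)
  next
    case (step k)
    then show ?case using closed steps(1)[of k] by metis
  qed
  have ray: "e k \<in> arcs (G \<restriction> V) \<and> head (G \<restriction> V) (e k) = tail (G \<restriction> V) (e (k + 1))"
    if "k \<ge> i" for k
    using inV[of k] inV[of "k + 1"] that steps(1)[of k] by simp
  obtain e' where e': "biwalk (G \<restriction> V) e'" "\<And>k. k \<ge> i \<Longrightarrow> e' k = e k"
    using periodic_past[of i e "G \<restriction> V" j, OF ray ij(2)] ij(4) by auto
  show ?thesis
  proof
    show "(\<lambda>k. l (e' k)) \<in> sofic_shift (G \<restriction> V) l" using e'(1) by (auto simp: sofic_shift_eq)
    show "l (e' k) = x k" if "k \<ge> a + int ?L" for k using that e'(2) ij by (simp add: e(2))
  qed
qed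

lemma sofic_shift_induce_subset: "sofic_shift (G \<restriction> V) l \<subseteq> sofic_shift G l"
  by (auto simp: sofic_shift_def)

lemma closedin_sofic_subshift:
  assumes "finite (arcs H)" "sofic_shift H l \<subseteq> sofic_shift G l"
  shows "closedin (Metric_space.mtopology (sofic_shift G l) rho) (sofic_shift H l)"
proof -
  interpret Submetric "sofic_shift G l" rho "sofic_shift H l"
    by (intro Submetric.intro Submetric_axioms.intro Metric_space_rho assms(2))
  have "compact_space (subtopology mtopology (sofic_shift H l))"
    using compact_sofic_shift[OF assms(1), of l] unfolding mtopology_submetric .
  then have "compactin mtopology (sofic_shift H l)"
    using assms(2) by (simp add: compactin_subspace)
  then show ?thesis using compactin_imp_closedin Hausdorff_space_mtopology by blast
qed

lemma shift_image_sofic_shift: "shift ` sofic_shift G l = sofic_shift G l"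
proof (intro equalityI subsetI)
  fix x assume "x \<in> sofic_shift G l"
  then have "(\<lambda>i. x (i + - 1)) \<in> sofic_shift G l" by (rule sofic_shift_translate)
  moreover have "x = shift (\<lambda>i. x (i + - 1))" by (simp add: shift_def)
  ultimately show "x \<in> shift ` sofic_shift G l" by blast
qed (auto intro: shift_in_sofic_shift)

text \<open>Starting in \<open>V\<close>, a walk that always follows some outgoing arc stays in \<open>V\<close> and revisits a
  vertex there; the loop supplies the past.\<close>

lemma (in fin_digraph) sofic_shift_nonempty:
  assumes "essential G" and v: "v \<in> V" "V \<subseteq> verts G"
    and closed: "\<And>e. e \<in> arcs G \<Longrightarrow> tail G e \<in> V \<Longrightarrow> head G e \<in> V"
  shows "sofic_shift (G \<restriction> V) l \<noteq> {}"
proof -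
  have "\<forall>w\<in>V. \<exists>e. e \<in> arcs G \<and> tail G e = w"
    using assms(1,3) unfolding essential_def by fastforce
  then obtain g where g: "\<And>w. w \<in> V \<Longrightarrow> g w \<in> arcs G \<and> tail G (g w) = w" by metis
  define U where "U n = ((\<lambda>w. head G (g w)) ^^ n) v" for n
  have U_Suc: "U (Suc n) = head G (g (U n))" for n by (simp add: U_def)
  have U: "U n \<in> V" for n
  proof (induction n)
    case 0
    show ?case using v(1) by (simp add: U_def)
  next
    case (Suc n)
    then show ?case using closed[of "g (U n)"] g by (auto simp: U_Suc)
  qed
  define e where "e i = g (U (nat i))" for i
  have ray: "e k \<in> arcs (G \<restriction> V) \<and> head (G \<restriction> V) (e k) = tail (G \<restriction> V) (e (k + 1))"
    if "k \<ge> 0" for k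
  proof -
    have "nat (k + 1) = Suc (nat k)" using that by simp
    then show ?thesis using g[OF U[of "nat k"]] g[OF U[of "Suc (nat k)"]] U[of "nat k"] U[of "Suc (nat k)"]
      by (simp add: e_def U_Suc)
  qed
  have "finite V" using v(2) finite_verts finite_subset by blast
  moreover have "tail G (e k) \<in> V" for k using g[OF U] U by (simp add: e_def)
  ultimately obtain i j where ij: "0 \<le> i" "i < j" "tail G (e i) = tail G (e j)"
    using finite_revisit[of V 0 "\<lambda>k. tail G (e k)"] by blast
  obtain e' where "biwalk (G \<restriction> V) e'"
    using periodic_past[of i e "G \<restriction> V" j, OF ray] ij by auto
  then show ?thesis by (auto simp: sofic_shift_eq)
qed

lemma (in fin_digraph) attractor_of_closed_set:
  assumes "essential G" and V: "V \<noteq> {}" "V \<subseteq> verts G"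
    and closed: "\<And>e. e \<in> arcs G \<Longrightarrow> tail G e \<in> V \<Longrightarrow> head G e \<in> V"
    and linked: "\<And>v w. (v, w) \<in> linked G l \<Longrightarrow> v \<in> V \<Longrightarrow> w \<in> V"
  shows "dynamical_system.attractor (sofic_shift G l) rho shift (sofic_shift (G \<restriction> V) l)"
proof -
  let ?Y = "sofic_shift (G \<restriction> V) l" and ?L = "card (verts G \<times> verts G)"
  have trapped: "factor x b m \<in> language ?Y"
    if x: "x \<in> sofic_shift G l" "factor x a ?L \<in> language ?Y" and b: "b \<ge> a + int ?L" for x a b m
  proof -
    obtain z where z: "z \<in> ?Y" "\<And>k. k \<ge> a + int ?L \<Longrightarrow> z k = x k"
      by (rule long_common_word_traps[of V l x a]) (use closed linked x in blast)+
    then have "factor x b m = factor z b m" using b by (simp add: factor_eq_iff)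
    then show ?thesis using z(1) factor_in_languageI by metis
  qed
  have "?Y \<noteq> {}" using V sofic_shift_nonempty[OF assms(1) _ V(2) closed] by blast
  moreover have "closedin (Metric_space.mtopology (sofic_shift G l) rho) ?Y"
    by (intro closedin_sofic_subshift sofic_shift_induce_subset) simp
  ultimately show ?thesis
    unfolding sofic_attractor_iff_words using trapped shift_image_sofic_shift by blast
qed

section \<open>Every attractor comes from such a vertex set\<close>

text \<open>The number \<open>n\<close> is the radius of the basin of attraction, measured in letters.  Only the
  limit condition determines it; stability is used later with windows of its own.\<close>

locale shift_attractor = fin_digraph G for G :: "('v, 'e) pre_digraph" +
  fixes l :: "'e \<Rightarrow> 'a" and Y :: "(int \<Rightarrow> 'a) set" and n :: nat
  assumes essential: "essential G"
    and attractor: "dynamical_system.attractor (sofic_shift G l) rho shift Y"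
    and limit: "\<And>x a m. x \<in> sofic_shift G l \<Longrightarrow> factor x a n \<in> language Y \<Longrightarrow>
      \<exists>c. \<forall>b\<ge>c. factor x b m \<in> language Y"
begin

lemma nonempty: "Y \<noteq> {}"
  and closedin: "closedin (Metric_space.mtopology (sofic_shift G l) rho) Y"
  and invariant: "shift ` Y = Y"
  and stable: "\<exists>k. \<forall>x\<in>sofic_shift G l. \<forall>a. factor x a k \<in> language Y \<longrightarrow>
    (\<forall>b\<ge>a + int k. factor x b m \<in> language Y)"
  using attractor unfolding sofic_attractor_iff_words by blast+

lemma subset: "Y \<subseteq> sofic_shift G l"
  using closedin Metric_space.closedin_metric[OF Metric_space_rho] by blast

text \<open>The initial word of length \<open>n\<close> puts every point that runs along \<open>p\<close> into the basin of
  attraction, whatever it does before and after; this gives closure under arcs for free.\<close>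

definition captured :: "'v set" where
  "captured = {v. \<exists>u p. awalk u p v \<and> n \<le> length p \<and> map l (take n p) \<in> language Y}"

lemma capturedI:
  "awalk u p v \<Longrightarrow> n \<le> length p \<Longrightarrow> map l (take n p) \<in> language Y \<Longrightarrow> v \<in> captured"
  unfolding captured_def by blast

lemma captured_subset: "captured \<subseteq> verts G"
  by (auto simp: captured_def)

lemma captured_awalk:
  assumes "v \<in> captured" "awalk v q w"
  shows "w \<in> captured"
proof -
  obtain u p where p: "awalk u p v" "n \<le> length p" "map l (take n p) \<in> language Y"
    using assms(1) by (auto simp: captured_def)
  have "awalk u (p @ q) w" using p(1) assms(2) by (rule awalk_appendI)
  moreover have "take n (p @ q) = take n p" using p(2) by simp
  ultimately show ?thesis using p(2,3) by (intro capturedI[of u "p @ q"]) simp_all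
qed

text \<open>A captured vertex is reached after a word that forces convergence to \<open>Y\<close>; going round a loop
  at it forever repeats the loop's label arbitrarily late, where only words of \<open>Y\<close> occur.\<close>

lemma captured_loop:
  assumes "v \<in> captured" and c: "awalk v c v"
  shows "map l c \<in> language Y"
proof (cases "c = []")
  case True
  obtain y where "y \<in> Y" using nonempty by blast
  then have "factor y 0 0 \<in> language Y" by (rule factor_in_languageI)
  then show ?thesis using True by (simp add: factor_def)
next
  case False
  obtain u p where p: "awalk u p v" "n \<le> length p" "map l (take n p) \<in> language Y"
    using assms(1) by (auto simp: captured_def)
  obtain e where e: "biwalk G e" "\<And>k. k < length p \<Longrightarrow> e (int k) = p ! k"
      "\<And>m k. k < length c \<Longrightarrow> e (int (length p + m * length c + k)) = c ! k"
    using lasso_biwalk[OF essential p(1) c False] by blast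
  define x where "x i = l (e i)" for i
  have x: "x \<in> sofic_shift G l" using e(1) unfolding sofic_shift_eq x_def by blast
  have "factor x 0 n = map l (take n p)"
    using p(2) e(2) by (intro nth_equalityI) (auto simp: x_def)
  then obtain d where d: "\<And>b. b \<ge> d \<Longrightarrow> factor x b (length c) \<in> language Y"
    using limit[OF x, of 0 "length c"] p(3) by auto
  let ?b = "length p + nat d * length c"
  have "nat d \<le> nat d * length c" using False by (cases c) auto
  then have "int ?b \<ge> d" by linarith
  then have "factor x (int ?b) (length c) \<in> language Y" by (rule d)
  moreover have "factor x (int ?b) (length c) = map l c"
    using e(3)[of _ "nat d"] by (intro nth_equalityI) (auto simp: x_def)
  ultimately show ?thesis by simp
qed

text \<open>Components enter the converse only through the fact that a walk inside one can be closed
  up to a loop.\<close>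

lemma restricted_follower_setE:
  assumes "s \<in> restricted_follower_set G l v"
  obtains p w q where "awalk v p w" "map l p = s" "awalk w q v"
proof -
  obtain K p w where K: "K \<in> sccs" "v \<in> verts K" "pre_digraph.awalk K v p w" "s = map l p"
    using assms by (auto simp: restricted_follower_set_def)
  then have sub: "subgraph K G" and sc: "strongly_connected K" by (auto simp: sccs_def)
  interpret K: wf_digraph K using sub by auto
  have "w \<in> verts K" using K(3) by auto
  then have "w \<rightarrow>\<^sup>*\<^bsub>K\<^esub> v" using sc K(2) by (auto simp: strongly_connected_def)
  then obtain q where "K.awalk w q v" using K.reachable_awalk by blast
  then show ?thesis using that K(3,4) subgraph_awalk_imp_awalk[OF _ sub] by metis
qed

text \<open>A common word of two linked vertices that is long enough can be closed up to a loop at the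
  captured one, so it is a word of \<open>Y\<close>; read at the other vertex it ends in a captured vertex of the
  same component.\<close>

lemma captured_linked:
  assumes "(u, w) \<in> linked G l" "u \<in> captured"
  shows "w \<in> captured"
proof -
  let ?C = "restricted_follower_set G l u \<inter> restricted_follower_set G l w"
  have inf: "infinite ?C" using assms(1) by (auto simp: linked_def)
  have "\<not> ?C \<subseteq> {s. set s \<subseteq> l ` arcs G \<and> length s \<le> n}" (is "\<not> _ \<subseteq> ?S")
    using inf finite_lists_length_le[OF finite_imageI[OF finite_arcs], of l n]
    by (meson finite_subset)
  then obtain s where s: "s \<in> ?C" and long: "s \<notin> ?S" by (auto simp only: subset_iff)
  have "set s \<subseteq> l ` arcs G"
  proof -
    have "s \<in> restricted_follower_set G l u" using s by blast
    then obtain p v q where "awalk u p v" "map l p = s" "awalk v q u"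
      by (rule restricted_follower_setE)
    then have "set p \<subseteq> arcs G" by auto
    then show ?thesis using \<open>map l p = s\<close> by (metis image_mono list.set_map)
  qed
  then have n: "n < length s" using long by simp
  obtain p1 w1 q1 where 1: "awalk u p1 w1" "map l p1 = s" "awalk w1 q1 u"
    using IntD1[OF s] by (rule restricted_follower_setE)
  obtain p2 w2 q2 where 2: "awalk w p2 w2" "map l p2 = s" "awalk w2 q2 w"
    using IntD2[OF s] by (rule restricted_follower_setE)
  have "map l (p1 @ q1) \<in> language Y"
    using captured_loop[OF assms(2) awalk_appendI[OF 1(1,3)]] .
  then have "s @ map l q1 \<in> language Y" using 1(2) by simp
  then obtain y a m where y: "y \<in> Y" "s @ map l q1 = factor y a m" by (auto simp: language_def)
  have "length s \<le> m" using arg_cong[OF y(2), of length] by simp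
  moreover have "take n s = take n (factor y a m)" using n by (simp flip: y(2))
  ultimately have "take n s = factor y a n" using n by (simp add: factor_def take_map)
  then have "map l (take n p2) \<in> language Y"
    using factor_in_languageI[OF y(1), of a n] 2(2) by (simp flip: take_map)
  moreover have "n \<le> length p2" using 2(2) n by auto
  ultimately have "w2 \<in> captured" using 2(1) by (intro capturedI)
  then show ?thesis using captured_awalk 2(3) by blast
qed

text \<open>In a walk through captured vertices some vertex recurs infinitely often in the past, so
  arbitrarily long words far to the left label loops and belong to \<open>Y\<close>; stability then
  carries closeness to \<open>Y\<close> up to the present.  Limits alone would not do: they only speak
  about the future.\<close>

lemma attractor_eq: "Y = sofic_shift (G \<restriction> captured) l"
proof (intro equalityI subsetI)
  fix y assume y: "y \<in> Y"
  then obtain e where e: "biwalk G e" "y = (\<lambda>i. l (e i))" using subset by (auto simp: sofic_shift_eq)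
  have "tail G (e i) \<in> captured" for i
  proof -
    have walk: "awalk (tail G (e (i - int n))) (factor e (i - int n) n) (tail G (e i))"
      using awalk_segment[OF wf_digraph_axioms, of "i - int n" e n] e(1) by (simp add: biwalk_def)
    have "map l (take n (factor e (i - int n) n)) \<in> language Y"
      using factor_in_languageI[OF y] e(2) by (simp add: map_factor)
    then show ?thesis by (intro capturedI[OF walk]) simp_all
  qed
  then have "biwalk (G \<restriction> captured) e" using e(1) by (auto simp: biwalk_def)
  then show "y \<in> sofic_shift (G \<restriction> captured) l" using e(2) by (auto simp: sofic_shift_eq)
next
  let ?X = "sofic_shift G l"
  fix z assume z: "z \<in> sofic_shift (G \<restriction> captured) l"
  have zX: "z \<in> ?X" using z sofic_shift_induce_subset by blast
  obtain f where f: "biwalk (G \<restriction> captured) f" "z = (\<lambda>i. l (f i))"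
    using z by (auto simp: sofic_shift_eq)
  have fs: "f i \<in> arcs G \<and> head G (f i) = tail G (f (i + 1))" "tail G (f i) \<in> captured" for i
    using f(1) by (auto simp: biwalk_def)
  have "finite ((\<lambda>k. tail G (f (- int k))) ` UNIV)"
    by (rule finite_subset[OF _ finite_verts]) (use fs(2) captured_subset in auto)
  then obtain k0 where k0: "infinite {k. tail G (f (- int k)) = tail G (f (- int k0))}"
    using pigeonhole_infinite[of "UNIV :: nat set" "\<lambda>k. tail G (f (- int k))"] by auto
  define v where "v = tail G (f (- int k0))"
  have recur: "\<exists>k\<ge>m. tail G (f (- int k)) = v" for m
    using k0 unfolding v_def infinite_nat_iff_unbounded_le by blast
  have words: "factor z b m \<in> language Y" for b m
  proof -
    obtain N where N: "\<And>x a b. x \<in> ?X \<Longrightarrow> factor x a N \<in> language Y \<Longrightarrow> b \<ge> a + int N \<Longrightarrow>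
        factor x b m \<in> language Y"
      using stable[of m] by metis
    obtain k1 where k1: "k1 \<ge> nat (- b)" "tail G (f (- int k1)) = v" using recur by blast
    obtain k2 where k2: "k2 \<ge> k1 + N" "tail G (f (- int k2)) = v" using recur by blast
    define a where "a = - int k2"
    have "awalk v (factor f a (k2 - k1)) v"
      using awalk_segment[OF wf_digraph_axioms, of a f "k2 - k1"] fs(1) k1(2) k2
      by (simp add: a_def of_nat_diff)
    moreover have "v \<in> captured" using fs(2) by (simp add: v_def)
    ultimately have "factor z a (k2 - k1) \<in> language Y"
      using captured_loop map_factor f(2) by metis
    then have "factor z a N \<in> language Y"
      by (rule factor_in_language_mono) (use k2(1) in auto)
    from N[OF zX this] show ?thesis by this (use k1(1) k2(1) in \<open>auto simp: a_def\<close>)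
  qed
  interpret Metric_space ?X rho by (rule Metric_space_rho)
  show "z \<in> Y"
  proof (rule ccontr)
    assume "z \<notin> Y"
    then obtain r where r: "r > 0" "disjnt Y (mball z r)"
      using closedin zX unfolding closedin_metric by blast
    obtain m :: nat where m: "(1 / 2) ^ m < r" using power_half_less r(1) by blast
    have "point_set_dist rho (\<lambda>i. z (i + 0)) Y < (1 / 2) ^ m"
      using point_set_dist_translate_less_iff[OF nonempty, of z 0 m]
        invariant_translate[OF invariant] words by blast
    then obtain y where "y \<in> Y" "\<forall>i. \<bar>i\<bar> \<le> int m \<longrightarrow> z i = y i"
      using point_set_dist_less_iff[OF nonempty, of z m] by auto
    then have "y \<in> Y" "rho z y < r" using m rho_less_iff[of z y m] by auto
    then have "y \<in> Y \<inter> mball z r" using subset zX by auto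
    then show False using r(2) by (auto simp: disjnt_def)
  qed
qed

end

section \<open>Terminal subgraphs of the linking graph\<close>

lemma link_class_in_quotient: "v \<in> verts G \<Longrightarrow> link_class G l v \<in> verts G // (linked G l)\<^sup>*"
  by (auto simp: quotient_def link_class_def)

lemma self_in_link_class: "v \<in> link_class G l v"
  by (simp add: link_class_def)

lemma link_class_of_mem:
  assumes "C \<in> verts G // (linked G l)\<^sup>*" "v \<in> C"
  shows "link_class G l v = C"
proof -
  obtain u where u: "C = link_class G l u" using assms(1) by (auto simp: quotient_def link_class_def)
  then have "(u, v) \<in> (linked G l)\<^sup>*" using assms(2) by (simp add: link_class_def)
  then show ?thesis using link_class_eq u by metis
qed

lemma link_class_subset:
  assumes "\<And>v w. (v, w) \<in> linked G l \<Longrightarrow> v \<in> V \<Longrightarrow> w \<in> V" "v \<in> V"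
  shows "link_class G l v \<subseteq> V"
proof
  fix w assume "w \<in> link_class G l v"
  then have "(v, w) \<in> (linked G l)\<^sup>*" by (simp add: link_class_def)
  then show "w \<in> V" using assms by (induction rule: rtrancl_induct) auto
qed

lemma (in wf_digraph) wf_linking_graph: "wf_digraph (linking_graph G l)"
  by unfold_locales (auto simp: linking_graph_def)

lemma (in wf_digraph) linking_graph_arc:
  assumes "e \<in> arcs G"
  shows "(link_class G l (tail G e), l e, link_class G l (head G e)) \<in> arcs (linking_graph G l)"
  using assms link_class_in_quotient[of _ G l] self_in_link_class[of _ G l]
  by (auto simp: linking_graph_def)

theorem mainTheorem3:
  fixes G :: "('v, 'e) pre_digraph" and l :: "'e \<Rightarrow> 'a::finite"
  assumes "fin_digraph G" and "essential G"
  shows "(\<forall>H. subgraph H (linking_graph G l) \<and> verts H \<noteq> {} \<and> terminal H (linking_graph G l)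
            \<longrightarrow> dynamical_system.attractor (sofic_shift G l) rho shift
                  (sofic_shift (link_preimage G l H) l))
       \<and> (\<forall>Y. dynamical_system.attractor (sofic_shift G l) rho shift Y
            \<longrightarrow> (\<exists>H. subgraph H (linking_graph G l) \<and> verts H \<noteq> {} \<and>
                     terminal H (linking_graph G l) \<and>
                     Y = sofic_shift (link_preimage G l H) l))"
proof -
  interpret fin_digraph G by fact
  let ?LG = "linking_graph G l"
  have LG: "verts ?LG = verts G // (linked G l)\<^sup>*" "tail ?LG = fst" "head ?LG = (\<lambda>t. snd (snd t))"
    by (auto simp: linking_graph_def)
  show ?thesis
  proof (intro conjI allI impI)
    fix H assume "subgraph H ?LG \<and> verts H \<noteq> {} \<and> terminal H ?LG"
    then have H: "subgraph H ?LG" "verts H \<noteq> {}" "terminal H ?LG" by auto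
    define V where "V = {v \<in> verts G. link_class G l v \<in> verts H}"
    obtain C where "C \<in> verts H" "C \<in> verts G // (linked G l)\<^sup>*"
      using H(1,2) LG(1) by (auto simp: subgraph_def)
    then have ne: "V \<noteq> {}"
      unfolding V_def quotient_def link_class_def by auto
    have "head G e \<in> V" if "e \<in> arcs G" "tail G e \<in> V" for e
      using H(3) linking_graph_arc[OF that(1), of l] that link_class_in_quotient[of "head G e" G l]
      unfolding terminal_def by (fastforce simp: V_def LG)
    moreover have "w \<in> V" if "(v, w) \<in> linked G l" "v \<in> V" for v w
      using that link_class_eq[OF r_into_rtrancl[OF that(1)]] by (auto simp: V_def linked_def)
    ultimately show "dynamical_system.attractor (sofic_shift G l) rho shift
        (sofic_shift (link_preimage G l H) l)"
      unfolding link_preimage_def V_def[symmetric]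
      by (intro attractor_of_closed_set assms(2) ne) (auto simp: V_def)
  next
    fix Y assume Y: "dynamical_system.attractor (sofic_shift G l) rho shift Y"
    then obtain n where "\<forall>x\<in>sofic_shift G l. \<forall>a. factor x a n \<in> language Y \<longrightarrow>
        (\<forall>m. \<exists>c. \<forall>b\<ge>c. factor x b m \<in> language Y)"
      unfolding sofic_attractor_iff_words by blast
    then interpret shift_attractor G l Y n
      using Y assms(2) by unfold_locales auto
    define H where "H = ?LG \<restriction> {C \<in> verts ?LG. C \<subseteq> captured}"
    interpret LG: wf_digraph ?LG by (rule wf_linking_graph)
    have verts_H: "link_class G l v \<in> verts H \<longleftrightarrow> v \<in> captured" if "v \<in> verts G" for v
    proof -
      have "link_class G l v \<subseteq> captured" if "v \<in> captured"
        by (rule link_class_subset[OF _ that]) (rule captured_linked)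
      then show ?thesis
        using self_in_link_class[of v G l] link_class_in_quotient[OF that, of l]
        by (auto simp: H_def LG)
    qed
    have "subgraph H ?LG" unfolding H_def by (rule induced_imp_subgraph) auto
    moreover have "link_preimage G l H = G \<restriction> captured"
    proof -
      have "{v \<in> verts G. link_class G l v \<in> verts H} = captured"
        using verts_H captured_subset by auto
      then show ?thesis by (simp add: link_preimage_def)
    qed
    moreover have "verts H \<noteq> {}"
    proof -
      obtain y where "y \<in> sofic_shift (G \<restriction> captured) l" using nonempty attractor_eq by blast
      then obtain v where "v \<in> captured" by (auto simp: sofic_shift_def)
      then show ?thesis using verts_H captured_subset by blast
    qed
    moreover have "terminal H ?LG"
      unfolding terminal_def
    proof (rule notI, elim bexE conjE)
      fix t assume t: "t \<in> arcs ?LG" "tail ?LG t \<in> verts H" "head ?LG t \<in> verts ?LG - verts H"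
      then obtain e where e: "e \<in> arcs G" "tail G e \<in> tail ?LG t" "head G e \<in> head ?LG t"
        by (auto simp: linking_graph_def)
      have "tail G e \<in> captured" using t(2) e(2) by (auto simp: H_def)
      then have "head G e \<in> captured"
        using captured_awalk arc_implies_awalk[OF e(1)] by blast
      moreover have "link_class G l (head G e) = head ?LG t"
        using t(3) e(3) by (intro link_class_of_mem) (auto simp: LG)
      ultimately show False using verts_H[of "head G e"] e(1) t(3) by auto
    qed
    ultimately show "\<exists>H. subgraph H ?LG \<and> verts H \<noteq> {} \<and> terminal H ?LG \<and>
        Y = sofic_shift (link_preimage G l H) l"
      using attractor_eq by (intro exI[of _ H]) simp
  qed
qed

end
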